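(* Let $Q_0\subset\mathbb{R}^n$ be a cube with $|Q_0|=1$. (a) If $n\ge 2$, there is a constant $C$ depending only on $n$ such that for every $f\in L^1(Q_0)$ $$\|f-f_{Q_0}\|_{e^{L^{n/(n-1)}}}\le C\,\|f\|_{\mathcal{O}^n(Q_0)}.$$ (b) If $n<p<\infty$, there is a constant $C$ depending only on $n$ and $p$ such that for every $f\in L^1(Q_0)$ $$\|f-f_{Q_0}\|_{L^\infty(Q_0)}\le C\,\|f\|_{\mathcal{O}^p(Q_0)}.$$
   Context: All integrals are with respect to Lebesgue measure. For a cube $Q$, $\ell(Q)$ is its sidelength, $|Q|$ its Lebesgue measure, $f_Q=\frac1{|Q|}\int_Q f$, and $O(f,Q)=\frac1{|Q|}\int_Q|f-f_Q|$. $\mathcal{D}(Q_0)$ denotes the collection of dyadic subcubes of $Q_0$, i.e. the cubes obtained by repeatedly bisecting the sides of $Q_0$ (including $Q_0$ itself). For $1\le p<\infty$ define $$\|f\|_{\mathcal{O}^p(Q_0)}=\Big(\sup_{\lambda>0}\lambda^p\sum_{Q\in\mathcal{D}(Q_0),\ O(f,Q)>\lambda}\ell(Q)^{-p}|Q|\Big)^{1/p}\in[0,\infty];$$ $\|f\|_{\mathcal{O}^n(Q_0)}$ is the case $p=n$. For a measurable function $g$ on $Q_0$ and $s\ge1$, $\|g\|_{e^{L^{s}}}=\inf\{t>0:\int_{Q_0}(\exp((|g(x)|/t)^{s})-1)\,dx\le 1\}$ is the exponential Orlicz (Luxemburg) norm on $Q_0$. *)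

theory Defs
  imports "HOL-Analysis.Analysis" "HOL-Probability.Essential_Supremum"
begin

(* Cubes are closed, axis-parallel and non-degenerate; the half-open and open
   variants differ from these by Lebesgue null sets only. *)

definition cube :: "real ^ 'n \<Rightarrow> real \<Rightarrow> (real ^ 'n) set" where
  "cube a l = cbox a (\<chi> i. a $ i + l)"

definition is_cube :: "(real ^ 'n) set \<Rightarrow> bool" where
  "is_cube Q \<longleftrightarrow> (\<exists>a l. 0 < l \<and> Q = cube a l)"

definition sidelength :: "(real ^ 'n) set \<Rightarrow> real" where
  "sidelength Q = (THE l. 0 < l \<and> (\<exists>a. Q = cube a l))"

lemma cube_inject:
  fixes a b :: "real ^ 'n"
  assumes "0 < l" "cube a l = cube b m"
  shows "a = b \<and> l = m"
proof -
  have ne: "cbox a (\<chi> i. a $ i + l) \<noteq> {}"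
    using assms(1) by (simp add: interval_ne_empty_cart less_imp_le)
  have "a = b \<and> (\<chi> i. a $ i + l) = (\<chi> i. b $ i + m)"
    using assms(2) ne unfolding cube_def by (metis eq_cbox)
  then show ?thesis
    by (metis add_left_cancel vec_lambda_beta)
qed

lemma sidelength_cube: "0 < l \<Longrightarrow> sidelength (cube a l) = l"
  unfolding sidelength_def by (rule the_equality) (use cube_inject in blast)+

(* Bisecting all sides of a cube with corner a and sidelength l gives the cubes of
   sidelength l/2 whose corner b satisfies b_i = a_i or b_i = a_i + l/2 for each i. *)

inductive_set dyadic_subcubes :: "(real ^ 'n) set \<Rightarrow> (real ^ 'n) set set"
  for Q0 :: "(real ^ 'n) set" where
  base: "Q0 \<in> dyadic_subcubes Q0"
| bisect: "\<lbrakk>cube a l \<in> dyadic_subcubes Q0; 0 < l; \<forall>i. b $ i = a $ i \<or> b $ i = a $ i + l / 2\<rbrakk>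
    \<Longrightarrow> cube b (l / 2) \<in> dyadic_subcubes Q0"

definition average :: "(real ^ 'n \<Rightarrow> real) \<Rightarrow> (real ^ 'n) set \<Rightarrow> real" where
  "average f Q = 1 / measure lebesgue Q * (LINT x|lebesgue_on Q. f x)"

definition mean_osc :: "(real ^ 'n \<Rightarrow> real) \<Rightarrow> (real ^ 'n) set \<Rightarrow> real" where
  "mean_osc f Q = 1 / measure lebesgue Q * (LINT x|lebesgue_on Q. \<bar>f x - average f Q\<bar>)"

(* Used for positive exponents only. *)

definition ennreal_powr :: "ennreal \<Rightarrow> real \<Rightarrow> ennreal" where
  "ennreal_powr x r = (if x = \<infinity> then \<infinity> else ennreal (enn2real x powr r))"

definition O_norm :: "real \<Rightarrow> (real ^ 'n) set \<Rightarrow> (real ^ 'n \<Rightarrow> real) \<Rightarrow> ennreal" where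
  "O_norm p Q0 f = ennreal_powr
     (SUP t\<in>{0<..}. ennreal (t powr p) *
        (\<Sum>\<^sub>\<infinity>Q\<in>{Q \<in> dyadic_subcubes Q0. mean_osc f Q > t}.
           ennreal (sidelength Q powr (- p) * measure lebesgue Q)))
     (1 / p)"

definition exp_Orlicz_norm :: "real \<Rightarrow> (real ^ 'n) set \<Rightarrow> (real ^ 'n \<Rightarrow> real) \<Rightarrow> ennreal" where
  "exp_Orlicz_norm s Q0 g = Inf {ennreal t | t. 0 < t \<and>
     (\<integral>\<^sup>+ x. ennreal (exp ((\<bar>g x\<bar> / t) powr s) - 1) \<partial>lebesgue_on Q0) \<le> 1}"

definition Linf_norm :: "(real ^ 'n) set \<Rightarrow> (real ^ 'n \<Rightarrow> real) \<Rightarrow> ennreal" where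
  "Linf_norm Q0 g = esssup (lebesgue_on Q0) (\<lambda>x. ennreal \<bar>g x\<bar>)"

end

theory Submission
  imports Defs
begin

text \<open>
  Suppose the norm of \<open>f\<close> is at most \<open>N\<close>. Let \<open>Q\<close> be a dyadic subcube of generation \<open>k\<close>. Along
  the chain of dyadic ancestors of \<open>Q\<close>, each step changes the average of \<open>f\<close> by at most \<open>2\<^sup>n\<close> times the mean
  oscillation over the larger cube. On the other hand, the integral of \<open>|f - f\<^sub>Q|\<close> over \<open>Q\<close>, summed over
  the cubes of generation \<open>k\<close>, is controlled by their mean oscillations. Markov's inequality thus
  bounds the superlevel sets of \<open>|f - f\<^bsub>Q0\<^esub>|\<close> for every \<open>k\<close>, without Lebesgue differentiation.

  For \<open>p = n\<close> the mean oscillations form a weak \<open>\<ell>\<^sup>n\<close> family, so those of \<open>m\<close> distinct cubes add up to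
  at most \<open>2 N m\<^bsup>1-1/n\<^esup>\<close>. Taking the \<open>k\<close> ancestors bounds the averages by a multiple of \<open>N k\<^bsup>1-1/n\<^esup>\<close>;
  taking the at most \<open>2\<^bsup>nk\<^esup>\<close> cubes of a generation gives measure at most \<open>2 / 2\<^sup>k\<close> for
  the corresponding superlevel set, and this is exponential integrability.
  For \<open>p > n\<close> the mean oscillations decay geometrically in the generation, so the averages stay bounded
  and the superlevel set is null.
\<close>

section \<open>Cubes and integrals over them\<close>

lemma measure_cube:
  fixes a :: "real ^ 'n"
  assumes "0 \<le> l"
  shows "measure lebesgue (cube a l) = l ^ CARD('n)"
proof -
  have "cbox a (\<chi> i. a $ i + l) \<noteq> {}"
    using assms by (simp add: interval_ne_empty_cart)
  then show ?thesis
    unfolding cube_def by (simp add: content_cbox_cart)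
qed

lemma lmeasurable_cube [simp]: "cube a l \<in> lmeasurable"
  by (simp add: cube_def)

lemma sets_cube [simp]: "cube a l \<in> sets lebesgue"
  by (simp add: cube_def)

lemma mem_cube: "x \<in> cube a l \<longleftrightarrow> (\<forall>i. a $ i \<le> x $ i \<and> x $ i \<le> a $ i + l)"
  by (simp add: cube_def mem_box_cart)

text \<open>Reduces the theorem to cubes of sidelength 1, so that the cubes of generation
  \<open>k\<close> have sidelength \<open>1 / 2 ^ k\<close>.\<close>

lemma is_cube_unit:
  fixes Q :: "(real ^ 'n) set"
  assumes "is_cube Q" "measure lebesgue Q = 1"
  obtains a where "Q = cube a 1"
proof -
  obtain a l where *: "0 < l" "Q = cube a l"
    using assms(1) by (auto simp: is_cube_def)
  have "l ^ CARD('n) = 1"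
    using assms(2) * measure_cube[of l a] by simp
  then have "l = 1"
    using *(1) by (metis less_imp_le power_eq_1_iff real_norm_def abs_of_pos zero_less_card_finite neq0_conv)
  with * that show ?thesis by blast
qed

lemma integrable_lebesgue_on_subset:
  fixes f :: "real ^ 'n \<Rightarrow> real"
  assumes "integrable (lebesgue_on T) f" "S \<subseteq> T" "S \<in> sets lebesgue" "T \<in> sets lebesgue"
  shows "integrable (lebesgue_on S) f"
  using assms set_integrable_subset[of lebesgue T f S]
  by (simp add: integrable_restrict_space set_integrable_def)

lemma integral_lebesgue_on_mono_set:
  fixes f :: "real ^ 'n \<Rightarrow> real"
  assumes "integrable (lebesgue_on T) f" "S \<subseteq> T" "S \<in> sets lebesgue" "T \<in> sets lebesgue"
    and "\<And>x. 0 \<le> f x"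
  shows "(LINT x|lebesgue_on S. f x) \<le> (LINT x|lebesgue_on T. f x)"
proof -
  have S: "integrable (lebesgue_on S) f"
    using assms integrable_lebesgue_on_subset by blast
  show ?thesis
    using S assms
    by (auto simp: integral_restrict_space integrable_restrict_space indicator_def
        intro!: integral_mono)
qed

lemma mean_osc_nonneg: "0 \<le> mean_osc f Q"
  by (simp add: mean_osc_def)

lemma integrable_const_cube [simp]: "integrable (lebesgue_on (cube a l)) (\<lambda>x. c :: real)"
  by (rule finite_measure.integrable_const[OF finite_measure_lebesgue_on[OF lmeasurable_cube]])

lemma integrable_diff_const_cube:
  fixes f :: "real ^ 'n \<Rightarrow> real"
  assumes "integrable (lebesgue_on (cube a l)) f"
  shows "integrable (lebesgue_on (cube a l)) (\<lambda>x. f x - c)"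
  using assms by (intro Bochner_Integration.integrable_diff) simp_all

text \<open>The half-size cube has \<open>1 / 2 ^ n\<close> of the measure of the large one, so
  averaging the deviation from \<open>average f (cube a l)\<close> over it instead costs at most the
  factor \<open>2 ^ n\<close>.\<close>

lemma average_subcube_diff:
  fixes f :: "real ^ 'n \<Rightarrow> real"
  assumes f: "integrable (lebesgue_on (cube a l)) f"
    and sub: "cube b (l / 2) \<subseteq> cube a l" and l: "0 < l"
  shows "\<bar>average f (cube b (l / 2)) - average f (cube a l)\<bar> \<le> 2 ^ CARD('n) * mean_osc f (cube a l)"
proof -
  define c where "c = average f (cube a l)"
  let ?Q = "cube a l" and ?R = "cube b (l / 2)"
  have mR: "measure lebesgue ?R = (l / 2) ^ CARD('n)" and mQ: "measure lebesgue ?Q = l ^ CARD('n)"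
    using l measure_cube[of "l/2" b] measure_cube[of l a] by auto
  have pos: "0 < (l / 2) ^ CARD('n)" using l by simp
  have fR: "integrable (lebesgue_on ?R) f"
    using integrable_lebesgue_on_subset[OF f sub] by simp
  have gQ: "integrable (lebesgue_on ?Q) (\<lambda>x. \<bar>f x - c\<bar>)"
    using integrable_diff_const_cube[OF f] by (rule integrable_abs)
  have iR: "(LINT x|lebesgue_on ?R. f x - c) = (LINT x|lebesgue_on ?R. f x) - c * (l / 2) ^ CARD('n)"
    using fR by (subst Bochner_Integration.integral_diff) (use l in \<open>auto simp: measure_restrict_space mR\<close>)
  have "average f ?R - c = (LINT x|lebesgue_on ?R. f x - c) / (l / 2) ^ CARD('n)"
    unfolding average_def mR iR using pos l by (simp add: diff_divide_distrib)
  then have "\<bar>average f ?R - c\<bar> \<le> (LINT x|lebesgue_on ?R. \<bar>f x - c\<bar>) / (l / 2) ^ CARD('n)"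
    using pos integral_abs_bound[of "lebesgue_on ?R" "\<lambda>x. f x - c"]
    by (simp add: abs_divide divide_right_mono)
  also have "\<dots> \<le> (LINT x|lebesgue_on ?Q. \<bar>f x - c\<bar>) / (l / 2) ^ CARD('n)"
    using pos integral_lebesgue_on_mono_set[OF gQ sub] by (intro divide_right_mono) auto
  also have "\<dots> = 2 ^ CARD('n) * mean_osc f ?Q"
    using l by (simp add: mean_osc_def mQ c_def power_divide)
  finally show ?thesis by (simp add: c_def)
qed

section \<open>Dyadic generations of a unit cube\<close>

text \<open>\<open>S\<close> is the set of coordinates in which the upper half of the bisected side
  is taken. Recording corners by depth supplies the generation number, which
  \<open>dyadic_subcubes\<close> does not carry, and lets the cubes be counted through subsets of
  the index type.\<close>

primrec dyadic_corners :: "real ^ 'n \<Rightarrow> nat \<Rightarrow> (real ^ 'n) set" where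
  "dyadic_corners a 0 = {a}"
| "dyadic_corners a (Suc k) =
     (\<Union>c\<in>dyadic_corners a k. range (\<lambda>S. \<chi> i. c $ i + (if i \<in> S then 1 / 2 ^ Suc k else 0)))"

definition dyadic_generation :: "real ^ 'n \<Rightarrow> nat \<Rightarrow> (real ^ 'n) set set" where
  "dyadic_generation a k = (\<lambda>c. cube c (1 / 2 ^ k)) ` dyadic_corners a k"

lemma finite_dyadic_corners: "finite (dyadic_corners a k)"
  by (induction k) auto

lemma card_dyadic_corners:
  fixes a :: "real ^ 'n"
  shows "card (dyadic_corners a k) \<le> 2 ^ (CARD('n) * k)"
proof (induction k)
  case (Suc k)
  have "card (dyadic_corners a (Suc k)) \<le>
      (\<Sum>c\<in>dyadic_corners a k. card (range (\<lambda>S. \<chi> i::'n. c $ i + (if i \<in> S then 1 / 2 ^ Suc k else 0))))"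
    by (simp add: card_UN_le finite_dyadic_corners)
  also have "\<dots> \<le> (\<Sum>c\<in>dyadic_corners a k. 2 ^ CARD('n))"
  proof (rule sum_mono)
    fix c :: "real ^ 'n"
    have "card (range (\<lambda>S. \<chi> i::'n. c $ i + (if i \<in> S then 1 / 2 ^ Suc k else 0))) \<le> card (UNIV :: 'n set set)"
      by (rule card_image_le) simp
    then show "card (range (\<lambda>S. \<chi> i::'n. c $ i + (if i \<in> S then 1 / 2 ^ Suc k else 0))) \<le> 2 ^ CARD('n)"
      by (simp add: card_UNIV_set)
  qed
  also have "\<dots> \<le> 2 ^ (CARD('n) * k) * 2 ^ CARD('n)"
    using Suc by simp
  finally show ?case by (simp add: power_add mult.commute)
qed simp

lemma finite_dyadic_generation: "finite (dyadic_generation a k)"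
  by (simp add: dyadic_generation_def finite_dyadic_corners)

lemma card_dyadic_generation:
  fixes a :: "real ^ 'n"
  shows "card (dyadic_generation a k) \<le> 2 ^ (CARD('n) * k)"
  unfolding dyadic_generation_def
  by (rule order_trans[OF card_image_le card_dyadic_corners]) (rule finite_dyadic_corners)

lemma dyadic_generation_subset: "dyadic_generation a k \<subseteq> dyadic_subcubes (cube a 1)"
proof (induction k)
  case 0
  then show ?case by (simp add: dyadic_generation_def dyadic_subcubes.base)
next
  case (Suc k)
  have "cube (\<chi> i. c $ i + (if i \<in> S then 1 / 2 ^ Suc k else 0)) ((1 / 2 ^ k) / 2) \<in> dyadic_subcubes (cube a 1)"
    if "c \<in> dyadic_corners a k" for c S
    using Suc that by (intro dyadic_subcubes.bisect[of c]) (auto simp: dyadic_generation_def)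
  then show ?case by (auto simp: dyadic_generation_def mult.commute)
qed

lemma dyadic_child_subset:
  fixes c :: "real ^ 'n"
  shows "cube (\<chi> i. c $ i + (if i \<in> S then 1 / 2 ^ Suc k else 0)) (1 / 2 ^ Suc k) \<subseteq> cube c (1 / 2 ^ k)"
proof
  fix x assume x: "x \<in> cube (\<chi> i. c $ i + (if i \<in> S then 1 / 2 ^ Suc k else 0)) (1 / 2 ^ Suc k)"
  have h: "(1::real) / 2 ^ Suc k + 1 / 2 ^ Suc k = 1 / 2 ^ k" by simp
  have p: "(0::real) < 1 / 2 ^ Suc k" by simp
  show "x \<in> cube c (1 / 2 ^ k)"
    unfolding mem_cube
  proof
    fix i
    have "c $ i + (if i \<in> S then 1 / 2 ^ Suc k else 0) \<le> x $ i \<and>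
       x $ i \<le> c $ i + (if i \<in> S then 1 / 2 ^ Suc k else 0) + 1 / 2 ^ Suc k"
      using x unfolding mem_cube by auto
    then show "c $ i \<le> x $ i \<and> x $ i \<le> c $ i + 1 / 2 ^ k"
      using h p by (smt (verit))
  qed
qed

lemma dyadic_generation_subset_cube:
  assumes "Q \<in> dyadic_generation a k"
  shows "Q \<subseteq> cube a 1"
  using assms
proof (induction k arbitrary: Q)
  case 0
  then show ?case by (simp add: dyadic_generation_def)
next
  case (Suc k)
  then obtain c S where c: "c \<in> dyadic_corners a k"
    and Q: "Q = cube (\<chi> i. c $ i + (if i \<in> S then 1 / 2 ^ Suc k else 0)) (1 / 2 ^ Suc k)"
    by (auto simp: dyadic_generation_def)
  show ?case
    using dyadic_child_subset[of c S k] Suc.IH[of "cube c (1 / 2 ^ k)"] c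
    unfolding Q dyadic_generation_def by blast
qed

text \<open>In each coordinate, keep a half that contains the point. The closed cubes share faces,
  which is harmless for the subadditive estimate built on this cover.\<close>

lemma dyadic_generation_cover: "cube a 1 \<subseteq> \<Union>(dyadic_generation a k)"
proof (induction k)
  case 0
  then show ?case by (simp add: dyadic_generation_def)
next
  case (Suc k)
  show ?case
  proof
    fix x assume "x \<in> cube a 1"
    then obtain c where c: "c \<in> dyadic_corners a k" and x: "x \<in> cube c (1 / 2 ^ k)"
      using Suc by (auto simp: dyadic_generation_def)
    define S where "S = {i. c $ i + 1 / 2 ^ Suc k \<le> x $ i}"
    define d where "d = (\<chi> i. c $ i + (if i \<in> S then 1 / 2 ^ Suc k else 0))"
    have h: "(1::real) / 2 ^ Suc k + 1 / 2 ^ Suc k = 1 / 2 ^ k" by simp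
    have "x \<in> cube d (1 / 2 ^ Suc k)"
      unfolding mem_cube
    proof
      fix i
      have "c $ i \<le> x $ i \<and> x $ i \<le> c $ i + 1 / 2 ^ k"
        using x unfolding mem_cube by auto
      then show "d $ i \<le> x $ i \<and> x $ i \<le> d $ i + 1 / 2 ^ Suc k"
        using h by (auto simp: d_def S_def simp del: power_Suc)
    qed
    moreover have "d \<in> dyadic_corners a (Suc k)"
      using c by (auto simp: d_def)
    ultimately show "x \<in> \<Union>(dyadic_generation a (Suc k))"
      unfolding dyadic_generation_def by blast
  qed
qed

section \<open>Ancestor chains and superlevel sets\<close>

text \<open>Telescoping along the ancestors of \<open>Q\<close>, with
  \<open>average_subcube_diff\<close> at each step. The chain \<open>q\<close> is kept explicit
  because its oscillations are summed in two ways later: by the number of cubes for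
  \<open>p = n\<close>, by a geometric series for \<open>p > n\<close>.\<close>

lemma average_chain:
  fixes f :: "real ^ 'n \<Rightarrow> real"
  assumes f: "integrable (lebesgue_on (cube a 1)) f"
    and "Q \<in> dyadic_generation a k"
  shows "\<exists>q. (\<forall>i<k. q i \<in> dyadic_generation a i) \<and>
    \<bar>average f Q - average f (cube a 1)\<bar> \<le> 2 ^ CARD('n) * (\<Sum>i<k. mean_osc f (q i))"
  using assms(2)
proof (induction k arbitrary: Q)
  case 0
  then show ?case by (simp add: dyadic_generation_def)
next
  case (Suc k)
  then obtain c S where c: "c \<in> dyadic_corners a k"
    and Q: "Q = cube (\<chi> i. c $ i + (if i \<in> S then 1 / 2 ^ Suc k else 0)) (1 / 2 ^ Suc k)"
    by (auto simp: dyadic_generation_def)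
  let ?P = "cube c (1 / 2 ^ k)"
  have P: "?P \<in> dyadic_generation a k"
    using c by (auto simp: dyadic_generation_def)
  obtain q where q: "\<forall>i<k. q i \<in> dyadic_generation a i"
    "\<bar>average f ?P - average f (cube a 1)\<bar> \<le> 2 ^ CARD('n) * (\<Sum>i<k. mean_osc f (q i))"
    using Suc.IH[OF P] by blast
  have fP: "integrable (lebesgue_on ?P) f"
    using integrable_lebesgue_on_subset[OF f dyadic_generation_subset_cube[OF P]] by simp
  have "Q \<subseteq> ?P"
    using dyadic_child_subset[of c S k] Q by simp
  moreover have half: "(1::real) / 2 ^ Suc k = (1 / 2 ^ k) / 2" by simp
  ultimately have "\<bar>average f Q - average f ?P\<bar> \<le> 2 ^ CARD('n) * mean_osc f ?P"
    unfolding Q half by (intro average_subcube_diff[OF fP]) auto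
  then have "\<bar>average f Q - average f (cube a 1)\<bar> \<le>
      2 ^ CARD('n) * (\<Sum>i<Suc k. mean_osc f ((q(k := ?P)) i))"
    using q(2) by (simp add: distrib_left)
  then show ?case
    using q(1) P by (intro exI[of _ "q(k := ?P)"]) (auto simp: less_Suc_eq)
qed

text \<open>The threshold splits into \<open>A\<close> for the drift of the averages and
  \<open>c\<close> for the oscillation inside a cube. By the triangle inequality a point above the
  threshold deviates by at least \<open>c\<close> from the average over any cube of generation
  \<open>k\<close> containing it; Markov's inequality on each cube and subadditivity
  conclude.\<close>

lemma superlevel_measure_bound:
  fixes f :: "real ^ 'n \<Rightarrow> real"
  assumes f: "integrable (lebesgue_on (cube a 1)) f" and c: "0 < c"
    and A: "\<And>Q. Q \<in> dyadic_generation a k \<Longrightarrow> \<bar>average f Q - average f (cube a 1)\<bar> \<le> A"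
  shows "emeasure (lebesgue_on (cube a 1)) {x \<in> cube a 1. A + c < \<bar>f x - average f (cube a 1)\<bar>}
    \<le> ennreal ((\<Sum>Q\<in>dyadic_generation a k. mean_osc f Q) / (2 ^ (CARD('n) * k) * c))"
proof -
  let ?D = "dyadic_generation a k"
  define E where "E Q = {x \<in> Q. c \<le> \<bar>f x - average f Q\<bar>}" for Q
  have E: "E Q \<in> sets lebesgue \<and> emeasure lebesgue (E Q) \<le> ennreal (mean_osc f Q / (2 ^ (CARD('n) * k) * c))"
    if Q: "Q \<in> ?D" for Q
  proof -
    obtain b where b: "Q = cube b (1 / 2 ^ k)"
      using Q by (auto simp: dyadic_generation_def)
    have m: "measure lebesgue Q = 1 / 2 ^ (CARD('n) * k)"
      using measure_cube[of "1 / 2 ^ k" b]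
      by (simp add: b power_divide power_mult[symmetric] mult.commute)
    have "integrable (lebesgue_on Q) f"
      using integrable_lebesgue_on_subset[OF f dyadic_generation_subset_cube[OF Q]] by (simp add: b)
    then have g: "integrable (lebesgue_on Q) (\<lambda>x. \<bar>f x - average f Q\<bar>)"
      unfolding b by (intro integrable_abs integrable_diff_const_cube)
    have EQ: "E Q = {x \<in> space (lebesgue_on Q). c \<le> \<bar>f x - average f Q\<bar>}"
      by (auto simp: E_def)
    have s: "E Q \<in> sets (lebesgue_on Q)"
      unfolding EQ using borel_measurable_integrable[OF g] by measurable
    then have s': "E Q \<in> sets lebesgue"
      by (auto simp: sets_restrict_space b intro: sets.Int[OF sets_cube])
    have "emeasure (lebesgue_on Q) (E Q) \<le> ennreal ((1 / c) * (LINT x|lebesgue_on Q. \<bar>f x - average f Q\<bar>))"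
      unfolding EQ by (rule integral_Markov_inequality[OF g]) (use c in auto)
    also have "(1 / c) * (LINT x|lebesgue_on Q. \<bar>f x - average f Q\<bar>) = mean_osc f Q / (2 ^ (CARD('n) * k) * c)"
      by (simp add: mean_osc_def m)
    finally show ?thesis
      using s' by (simp add: emeasure_restrict_space b E_def)
  qed
  let ?L = "{x \<in> cube a 1. A + c < \<bar>f x - average f (cube a 1)\<bar>}"
  have L: "?L \<subseteq> (\<Union>Q\<in>?D. E Q)"
  proof
    fix x assume x: "x \<in> ?L"
    then obtain Q where Q: "Q \<in> ?D" "x \<in> Q"
      using dyadic_generation_cover[of a k] by blast
    have "c \<le> \<bar>f x - average f Q\<bar>"
      using A[OF Q(1)] x by auto
    then show "x \<in> (\<Union>Q\<in>?D. E Q)"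
      using Q by (auto simp: E_def)
  qed
  have "emeasure (lebesgue_on (cube a 1)) ?L = emeasure lebesgue ?L"
    by (rule emeasure_restrict_space) auto
  also have "\<dots> \<le> emeasure lebesgue (\<Union>Q\<in>?D. E Q)"
    using L E by (intro emeasure_mono sets.finite_UN[OF finite_dyadic_generation]) auto
  also have "\<dots> \<le> (\<Sum>Q\<in>?D. emeasure lebesgue (E Q))"
    using E by (intro emeasure_subadditive_finite[OF finite_dyadic_generation]) auto
  also have "\<dots> \<le> (\<Sum>Q\<in>?D. ennreal (mean_osc f Q / (2 ^ (CARD('n) * k) * c)))"
    using E by (intro sum_mono) blast
  also have "\<dots> = ennreal ((\<Sum>Q\<in>?D. mean_osc f Q) / (2 ^ (CARD('n) * k) * c))"
    using c by (subst sum_ennreal) (auto simp: mean_osc_nonneg sum_divide_distrib)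
  finally show ?thesis .
qed

section \<open>The norm as a weak-type bound\<close>

text \<open>The only access to the norm: it is turned into a real inequality for one level
  \<open>t\<close> and one finite family of cubes.\<close>

lemma O_norm_bound:
  assumes N: "O_norm p Q0 f \<le> ennreal N" and "0 < N" "0 < p" "0 < t" "finite F"
    and F: "F \<subseteq> {Q \<in> dyadic_subcubes Q0. t < mean_osc f Q}"
  shows "t powr p * (\<Sum>Q\<in>F. sidelength Q powr (- p) * measure lebesgue Q) \<le> N powr p"
proof -
  define T where "T t = ennreal (t powr p) *
        (\<Sum>\<^sub>\<infinity>Q\<in>{Q \<in> dyadic_subcubes Q0. mean_osc f Q > t}.
           ennreal (sidelength Q powr (- p) * measure lebesgue Q))" for t
  define S where "S = (SUP t\<in>{0<..}. T t)"
  have S: "ennreal_powr S (1 / p) \<le> ennreal N"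
    using N by (simp add: O_norm_def S_def T_def)
  \<comment> \<open>\<open>ennreal_powr\<close> keeps infinity infinite, so the bound forces
    \<open>S\<close> to be finite and \<open>enn2real\<close> does not fall back to its default
    value 0.\<close>
  then have fin: "S \<noteq> \<infinity>"
    by (auto simp: ennreal_powr_def top_unique)
  then have "enn2real S powr (1 / p) \<le> N"
    using S \<open>0 < N\<close> by (simp add: ennreal_powr_def)
  then have "(enn2real S powr (1 / p)) powr p \<le> N powr p"
    using \<open>0 < p\<close> by (intro powr_mono2) auto
  then have "enn2real S \<le> N powr p"
    using \<open>0 < p\<close> by (simp add: powr_powr)
  then have "S \<le> ennreal (N powr p)"
    using fin by (metis ennreal_enn2real_if ennreal_leI infinity_ennreal_def)
  moreover have "T t \<le> S"
    unfolding S_def using \<open>0 < t\<close> by (intro SUP_upper) auto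
  moreover have "ennreal (t powr p * (\<Sum>Q\<in>F. sidelength Q powr (- p) * measure lebesgue Q)) \<le> T t"
  proof -
    have "(\<Sum>Q\<in>F. ennreal (sidelength Q powr (- p) * measure lebesgue Q)) =
      (\<Sum>\<^sub>\<infinity>Q\<in>F. ennreal (sidelength Q powr (- p) * measure lebesgue Q))"
      using \<open>finite F\<close> by simp
    also have "\<dots> \<le> (\<Sum>\<^sub>\<infinity>Q\<in>{Q \<in> dyadic_subcubes Q0. mean_osc f Q > t}.
           ennreal (sidelength Q powr (- p) * measure lebesgue Q))"
      using F by (intro infsum_mono_neutral nonneg_summable_on_complete) auto
    finally show ?thesis
      unfolding T_def by (subst ennreal_mult') (auto simp: sum_ennreal[symmetric] simp del: sum_ennreal intro!: mult_left_mono)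
  qed
  ultimately have "ennreal (t powr p * (\<Sum>Q\<in>F. sidelength Q powr (- p) * measure lebesgue Q)) \<le> ennreal (N powr p)"
    by order
  then show ?thesis by simp
qed

text \<open>The \<open>j\<close>-th largest value of \<open>g\<close> is at most
  \<open>N * j powr (- 1 / n)\<close>, and the sum of \<open>j powr (- 1 / n)\<close> up to
  \<open>m\<close> is at most \<open>m powr (1 - 1 / n) / (1 - 1 / n)\<close>; the constant 2 comes
  from \<open>n \<ge> 2\<close>. Induction on the cardinality replaces sorting.\<close>

lemma weak_lp_sum:
  fixes g :: "'a \<Rightarrow> real"
  assumes "finite F" and n: "2 \<le> n" and N: "0 < N" and g: "\<And>x. x \<in> F \<Longrightarrow> 0 \<le> g x"
    and weak: "\<And>t. 0 < t \<Longrightarrow> t powr n * real (card {x \<in> F. t < g x}) \<le> N powr n"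
  shows "sum g F \<le> 2 * N * real (card F) powr (1 - 1 / n)"
  using \<open>finite F\<close> g weak
proof (induction "card F" arbitrary: F)
  case 0
  then show ?case by simp
next
  case (Suc m)
  define M where "M = real (Suc m)"
  define s where "s = 1 - 1 / n"
  have s: "1 / 2 \<le> s" "s \<le> 1" using n by (auto simp: s_def field_simps)
  have M: "1 \<le> M" by (simp add: M_def)
  have "F \<noteq> {}" using Suc by auto
  \<comment> \<open>Removing a minimiser \<open>y\<close>: since all values are at least \<open>g y\<close>, the weak bound controls \<open>g y\<close>.\<close>
  then obtain y where y: "y \<in> F" "\<And>x. x \<in> F \<Longrightarrow> g y \<le> g x"
    using Suc.prems(1) arg_min_if_finite(1) arg_min_least by metis
  have min: "g y \<le> N * M powr (- 1 / n)"
  \<comment> \<open>The weak bound counts values strictly above the level, so it is applied at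
    \<open>z * g y\<close> with \<open>z < 1\<close> rather than at \<open>g y\<close>
    itself.\<close>
  proof (rule field_le_mult_one_interval)
    fix z :: real assume z: "0 < z" "z < 1"
    show "z * g y \<le> N * M powr (- 1 / n)"
    proof (cases "g y = 0")
      case True
      then show ?thesis using N by simp
    next
      case False
      then have gy: "0 < g y" using Suc.prems(2) y(1) by (simp add: less_le)
      then have "z * g y < 1 * g y"
        using z by (intro mult_strict_right_mono) auto
      then have "z * g y < g x" if "x \<in> F" for x
        using y(2)[OF that] by simp
      then have "{x \<in> F. z * g y < g x} = F" by auto
      then have "(z * g y) powr n * M \<le> N powr n"
        using Suc.prems(3)[of "z * g y"] z gy Suc.hyps(2) by (simp add: M_def)
      then have "((z * g y) powr n * M) powr (1 / n) \<le> (N powr n) powr (1 / n)"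
        using n M by (intro powr_mono2) auto
      then have "(z * g y) * M powr (1 / n) \<le> N"
        using n M N z gy by (simp add: powr_mult powr_powr)
      then show ?thesis
        using M by (simp add: powr_minus field_simps)
    qed
  qed
  let ?G = "F - {y}"
  have cG: "card ?G = m" using Suc.hyps(2) Suc.prems(1) y(1) by simp
  have "sum g ?G \<le> 2 * N * real (card ?G) powr (1 - 1 / n)"
  proof (rule Suc.hyps(1))
    fix t :: real assume t: "0 < t"
    have "card {x \<in> ?G. t < g x} \<le> card {x \<in> F. t < g x}"
      using Suc.prems(1) by (intro card_mono) auto
    then have "t powr n * real (card {x \<in> ?G. t < g x}) \<le> t powr n * real (card {x \<in> F. t < g x})"
      by (intro mult_left_mono) auto
    then show "t powr n * real (card {x \<in> ?G. t < g x}) \<le> N powr n"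
      using Suc.prems(3)[OF t] by linarith
  qed (use cG Suc.prems in auto)
  then have G: "sum g ?G \<le> 2 * N * (M - 1) powr s"
    unfolding cG by (simp add: M_def s_def)
  \<comment> \<open>Bernoulli's inequality \<open>(1 - 1/M)\<^sup>s \<le> 1 - s/M\<close>, scaled by \<open>M\<^sup>s\<close>.\<close>
  have "(M - 1) powr s \<le> M powr s - s * M powr (s - 1)"
  proof -
    have "(1 - 1 / M) powr s \<le> 1 - s / M"
    proof (cases "M = 1")
      case True
      then show ?thesis using s by simp
    next
      case False
      then have "1 < M" using M by simp
      then have "(1 - 1 / M) powr s * 1 powr (1 - s) \<le> s * (1 - 1 / M) + (1 - s) * 1"
        using s by (intro Youngs_inequality_0) auto
      then show ?thesis by (simp add: algebra_simps)
    qed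
    then have "M powr s * (1 - 1 / M) powr s \<le> M powr s * (1 - s / M)"
      by (intro mult_left_mono) auto
    moreover have "M powr s * (1 - 1 / M) powr s = (M - 1) powr s"
      using M by (subst powr_mult[symmetric]) (auto simp: algebra_simps)
    moreover have "M powr s * (1 - s / M) = M powr s - s * M powr (s - 1)"
      using M by (simp add: powr_diff algebra_simps)
    ultimately show ?thesis by simp
  qed
  then have "2 * N * (M - 1) powr s \<le> 2 * N * (M powr s - s * M powr (s - 1))"
    using N by (intro mult_left_mono) auto
  \<comment> \<open>Since \<open>2 * s \<ge> 1\<close>, the loss in Bernoulli's inequality, doubled,
    absorbs the bound on \<open>g y\<close>.\<close>
  moreover have "N * M powr (s - 1) * 1 \<le> N * M powr (s - 1) * (2 * s)"
    using N s by (intro mult_left_mono) auto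
  moreover have "s - 1 = - 1 / n" by (simp add: s_def)
  moreover have "sum g F = g y + sum g ?G"
    using Suc.prems(1) y(1) by (simp add: sum.remove)
  ultimately have "sum g F \<le> 2 * N * M powr s"
    using G min by (simp add: algebra_simps)
  then show ?case by (simp add: M_def s_def Suc.hyps(2)[symmetric])
qed


section \<open>Exponential integrability for \<open>p = n\<close>\<close>

text \<open>Slicing by the values of \<open>u\<close>: those in \<open>(k, k + 1]\<close> contribute
  at most \<open>exp ((k + 1) / 2)\<close> times a tail of size \<open>2 / 2 ^ k\<close>. Halving
  the exponent is what makes this series converge.\<close>

lemma nn_integral_exp_half_bound:
  fixes u :: "'a \<Rightarrow> real"
  assumes u [measurable]: "u \<in> borel_measurable M" and nonneg: "\<And>x. 0 \<le> u x"
    and tail: "\<And>k::nat. emeasure M {x \<in> space M. real k < u x} \<le> ennreal (2 / 2 ^ k)"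
  shows "(\<integral>\<^sup>+x. ennreal (exp (u x / 2) - 1) \<partial>M) \<le> ennreal (\<Sum>k. exp ((real k + 1) / 2) * (2 / 2 ^ k))"
proof -
  let ?E = "\<lambda>k. {x \<in> space M. real k < u x}"
  let ?e = "\<lambda>k::nat. exp ((real k + 1) / 2) :: real"
  \<comment> \<open>\<open>exp 1 \<le> 3 < 4\<close>, so the geometric ratio
    \<open>exp (1 / 2) / 2\<close> is below 1.\<close>
  have "exp (1 / 2 :: real) ^ 2 < 2 ^ 2"
    using exp_le by (simp add: exp_double[symmetric])
  then have lt: "exp (1 / 2 :: real) < 2"
    by (rule power_less_imp_less_base) simp
  have eq: "?e k * (2 / 2 ^ k) = 2 * exp (1 / 2) * (exp (1 / 2) / 2) ^ k" for k
    by (simp add: add_divide_distrib exp_add power_divide exp_of_nat_mult[symmetric])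
  have sm: "summable (\<lambda>k. ?e k * (2 / 2 ^ k))"
    unfolding eq using lt by (intro summable_mult summable_geometric) simp
  have "ennreal (exp (u x / 2) - 1) \<le> (\<Sum>k. ennreal (?e k) * indicator (?E k) x)" if "x \<in> space M" for x
  proof (cases "u x = 0")
    case False
    then have pos: "0 < u x" using nonneg[of x] by simp
    define k where "k = nat (\<lceil>u x\<rceil> - 1)"
    have k: "real k < u x" "u x \<le> real k + 1"
      using pos unfolding k_def by linarith+
    have "ennreal (exp (u x / 2) - 1) \<le> ennreal (?e k)"
      using k(2) by (intro ennreal_leI) (smt (verit) divide_right_mono exp_le_cancel_iff)
    also have "\<dots> = (\<Sum>i\<in>{k}. ennreal (?e i) * indicator (?E i) x)"
      using k(1) that by simp
    also have "\<dots> \<le> (\<Sum>k. ennreal (?e k) * indicator (?E k) x)"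
      by (intro sum_le_suminf) auto
    finally show ?thesis .
  qed simp
  then have "(\<integral>\<^sup>+x. ennreal (exp (u x / 2) - 1) \<partial>M)
      \<le> (\<integral>\<^sup>+x. (\<Sum>k. ennreal (?e k) * indicator (?E k) x) \<partial>M)"
    by (rule nn_integral_mono)
  also have "\<dots> = (\<Sum>k. ennreal (?e k) * emeasure M (?E k))"
    by (subst nn_integral_suminf) (auto simp: nn_integral_cmult_indicator)
  also have "\<dots> \<le> (\<Sum>k. ennreal (?e k * (2 / 2 ^ k)))"
  proof (intro suminf_le summableI)
    fix k
    have "ennreal (?e k * (2 / 2 ^ k)) = ennreal (?e k) * ennreal (2 / 2 ^ k)"
      by (rule ennreal_mult) auto
    then show "ennreal (?e k) * emeasure M (?E k) \<le> ennreal (?e k * (2 / 2 ^ k))"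
      using mult_left_mono[OF tail, of "ennreal (?e k)" k] by simp
  qed
  also have "\<dots> = ennreal (\<Sum>k. ?e k * (2 / 2 ^ k))"
    using sm by (intro suminf_ennreal2) auto
  finally show ?thesis .
qed

text \<open>For \<open>p = n\<close> every cube has weight
  \<open>sidelength Q powr (- n) * measure lebesgue Q = 1\<close>, so the norm merely counts cubes
  and \<open>weak_lp_sum\<close> applies.\<close>

lemma mean_osc_sum_bound:
  fixes a :: "real ^ 'n"
  assumes N: "O_norm (real CARD('n)) (cube a 1) f \<le> ennreal N" "0 < N" and n: "2 \<le> CARD('n)"
    and F: "finite F" "F \<subseteq> (\<Union>k. dyadic_generation a k)"
  shows "(\<Sum>Q\<in>F. mean_osc f Q) \<le> 2 * N * real (card F) powr (1 - 1 / real CARD('n))"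
proof (rule weak_lp_sum[OF F(1)])
  fix t :: real assume t: "0 < t"
  let ?G = "{Q \<in> F. t < mean_osc f Q}"
  have "sidelength Q powr (- real CARD('n)) * measure lebesgue Q = 1" if Q: "Q \<in> F" for Q
  proof -
    obtain k where "Q \<in> dyadic_generation a k"
      using Q F(2) by blast
    then obtain c where c: "Q = cube c (1 / 2 ^ k)"
      unfolding dyadic_generation_def by blast
    show ?thesis
      using measure_cube[of "1 / 2 ^ k" c] sidelength_cube[of "1 / 2 ^ k" c]
      by (simp add: c powr_minus powr_realpow)
  qed
  then have "real (card ?G) = (\<Sum>Q\<in>?G. sidelength Q powr (- real CARD('n)) * measure lebesgue Q)"
    by simp
  also have "t powr real CARD('n) * \<dots> \<le> N powr real CARD('n)"
    using F t N dyadic_generation_subset[of a] by (intro O_norm_bound[of _ "cube a 1" f]) auto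
  finally show "t powr real CARD('n) * real (card ?G) \<le> N powr real CARD('n)"
    by simp
qed (use n N mean_osc_nonneg in auto)

lemma superlevel_decay:
  fixes a :: "real ^ 'n"
  assumes f: "integrable (lebesgue_on (cube a 1)) f"
    and N: "O_norm (real CARD('n)) (cube a 1) f \<le> ennreal N" "0 < N" and n: "2 \<le> CARD('n)"
  shows "emeasure (lebesgue_on (cube a 1))
     {x \<in> cube a 1. 2 ^ CARD('n) * (2 * N * real k powr (1 - 1 / real CARD('n))) + N
        < \<bar>f x - average f (cube a 1)\<bar>} \<le> ennreal (2 / 2 ^ k)"
proof -
  define s where "s = 1 - 1 / real CARD('n)"
  have "emeasure (lebesgue_on (cube a 1))
     {x \<in> cube a 1. 2 ^ CARD('n) * (2 * N * real k powr s) + N < \<bar>f x - average f (cube a 1)\<bar>}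
     \<le> ennreal ((\<Sum>Q\<in>dyadic_generation a k. mean_osc f Q) / (2 ^ (CARD('n) * k) * N))"
  \<comment> \<open>Choosing \<open>c = N\<close> cancels the factor \<open>N\<close> in the sum of
    the mean oscillations.\<close>
  proof (rule superlevel_measure_bound[OF f N(2)])
    fix Q assume Q: "Q \<in> dyadic_generation a k"
    obtain q where q: "\<And>i. i < k \<Longrightarrow> q i \<in> dyadic_generation a i"
      "\<bar>average f Q - average f (cube a 1)\<bar> \<le> 2 ^ CARD('n) * (\<Sum>i<k. mean_osc f (q i))"
      using average_chain[OF f Q] by blast
    \<comment> \<open>Cubes of different generations differ in sidelength, so the chain consists of
      exactly \<open>k\<close> cubes.\<close>
    have "inj_on q {..<k}"
    proof
      fix i j assume ij: "i \<in> {..<k}" "j \<in> {..<k}" and eq: "q i = q j"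
      have "q i \<in> dyadic_generation a i" "q j \<in> dyadic_generation a j"
        using q(1) ij by simp_all
      then obtain b c where bc: "q i = cube b (1 / 2 ^ i)" "q j = cube c (1 / 2 ^ j)"
        unfolding dyadic_generation_def by blast
      have "cube b (1 / 2 ^ i) = cube c (1 / 2 ^ j)"
        using eq by (simp only: bc)
      then have "(1 :: real) / 2 ^ i = 1 / 2 ^ j"
        using cube_inject[of "1 / 2 ^ i" b c "1 / 2 ^ j"] by simp
      then show "i = j"
        by simp
    qed
    then have c: "card (q ` {..<k}) = k"
      and r: "(\<Sum>i<k. mean_osc f (q i)) = (\<Sum>Q\<in>q ` {..<k}. mean_osc f Q)"
      by (simp_all add: card_image sum.reindex)
    note r
    also have "(\<Sum>Q\<in>q ` {..<k}. mean_osc f Q) \<le> 2 * N * real (card (q ` {..<k})) powr s"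
      unfolding s_def using q(1) by (intro mean_osc_sum_bound[OF N n]) auto
    finally have "2 ^ CARD('n) * (\<Sum>i<k. mean_osc f (q i)) \<le> 2 ^ CARD('n) * (2 * N * real k powr s)"
      unfolding c by (rule mult_left_mono) simp
    then show "\<bar>average f Q - average f (cube a 1)\<bar> \<le> 2 ^ CARD('n) * (2 * N * real k powr s)"
      using q(2) by linarith
  qed
  also have "\<dots> \<le> ennreal (2 / 2 ^ k)"
  proof (rule ennreal_leI)
    \<comment> \<open>Since \<open>n * s = n - 1\<close>, the at most \<open>2 ^ (n * k)\<close>
      cubes give a sum of at most \<open>2 * N * 2 ^ (n * k) / 2 ^ k\<close>.\<close>
    have "(\<Sum>Q\<in>dyadic_generation a k. mean_osc f Q) \<le> 2 * N * real (card (dyadic_generation a k)) powr s"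
      unfolding s_def by (intro mean_osc_sum_bound[OF N n] finite_dyadic_generation) auto
    also have "\<dots> \<le> 2 * N * real (2 ^ (CARD('n) * k)) powr s"
      using N(2) n by (intro mult_left_mono powr_mono2 of_nat_mono card_dyadic_generation)
        (auto simp: s_def field_simps)
    also have "real (2 ^ (CARD('n) * k)) powr s = 2 powr (real CARD('n) * real k * s)"
      by (simp add: powr_realpow[symmetric] powr_powr)
    also have "real CARD('n) * real k * s = real (CARD('n) * k) - real k"
      by (simp add: s_def algebra_simps)
    also have "2 powr \<dots> = (2::real) ^ (CARD('n) * k) / 2 ^ k"
      by (simp only: powr_diff powr_realpow zero_less_numeral)
    finally show "(\<Sum>Q\<in>dyadic_generation a k. mean_osc f Q) / (2 ^ (CARD('n) * k) * N) \<le> 2 / 2 ^ k"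
      using N(2) by (simp add: field_simps)
  qed
  finally show ?thesis by (simp add: s_def)
qed

text \<open>The thresholds of \<open>superlevel_decay\<close> grow like \<open>k powr s\<close>, so
  the power \<open>r = 1 / s\<close> of the normalised deviation has tails
  \<open>2 / 2 ^ k\<close>.\<close>

lemma exp_Orlicz_norm_bound:
  assumes n: "2 \<le> CARD('n)"
  obtains C where "0 < C"
    "\<And>(a :: real ^ 'n) f N. \<lbrakk>integrable (lebesgue_on (cube a 1)) f; 0 < N;
        O_norm (real CARD('n)) (cube a 1) f \<le> ennreal N\<rbrakk> \<Longrightarrow>
      exp_Orlicz_norm (real CARD('n) / (real CARD('n) - 1)) (cube a 1) (\<lambda>x. f x - average f (cube a 1))
        \<le> ennreal (C * N)"
proof -
  define s r where "s = 1 - 1 / real CARD('n)" and "r = real CARD('n) / (real CARD('n) - 1)"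
  have s: "0 < s" "0 < r" "s * r = 1" "r * s = 1"
    using n by (auto simp: s_def r_def field_simps)
  \<comment> \<open>\<open>N * B * k powr s\<close> dominates both terms of the threshold in
    \<open>superlevel_decay\<close> once \<open>k \<ge> 1\<close>.\<close>
  define B where "B = 2 ^ CARD('n) * 2 + (1::real)"
  have B: "0 < B" by (simp add: B_def add_pos_pos)
  define K0 where "K0 = (\<Sum>k. exp ((real k + 1) / 2) * (2 / 2 ^ k) :: real)"
  \<comment> \<open>Dividing the exponent by \<open>K \<ge> 1\<close> divides \<open>exp - 1\<close> by at least \<open>K\<close> (convexity), which brings the
    integral below 1.\<close>
  define K where "K = max 1 K0"
  have K: "1 \<le> K" "K0 \<le> K" by (auto simp: K_def)
  \<comment> \<open>As \<open>s * r = 1\<close>, the factor \<open>(2 * K) powr s\<close> divides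
    the \<open>r\<close>-th power \<open>u\<close> by exactly \<open>2 * K\<close>.\<close>
  define C where "C = B * (2 * K) powr s"
  have C: "0 < C" using B K by (simp add: C_def)
  moreover have "exp_Orlicz_norm r (cube a 1) (\<lambda>x. f x - average f (cube a 1)) \<le> ennreal (C * N)"
    if f: "integrable (lebesgue_on (cube a 1)) f" and N: "0 < N"
      "O_norm (real CARD('n)) (cube a 1) f \<le> ennreal N" for a :: "real ^ 'n" and f N
  proof -
    let ?M = "lebesgue_on (cube a 1)"
    define g where "g x = \<bar>f x - average f (cube a 1)\<bar>" for x
    have [measurable]: "f \<in> borel_measurable ?M"
      using f by (rule borel_measurable_integrable)
    have g [measurable]: "g \<in> borel_measurable ?M"
      unfolding g_def[abs_def] by measurable
    define u where "u x = (g x / (N * B)) powr r" for x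
    have u [measurable]: "u \<in> borel_measurable ?M"
      unfolding u_def[abs_def] by measurable
    have tail: "emeasure ?M {x \<in> space ?M. real k < u x} \<le> ennreal (2 / 2 ^ k)" for k
    \<comment> \<open>For \<open>k = 0\<close> the summand \<open>N\<close> cannot be absorbed into
      \<open>k powr s = 0\<close>; there the total measure 1 is already below 2.\<close>
    proof (cases "k = 0")
      case True
      have "emeasure ?M {x \<in> space ?M. real k < u x} \<le> emeasure ?M (space ?M)"
        by (rule emeasure_space)
      also have "\<dots> = emeasure lebesgue (cube a 1)"
        by (simp add: emeasure_restrict_space)
      also have "\<dots> = ennreal 1"
        using measure_cube[of 1 a] by (subst emeasure_eq_measure2) auto
      also have "\<dots> \<le> ennreal (2 / 2 ^ k)"
        using True by (intro ennreal_leI) simp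
      finally show ?thesis .
    next
      case False
      have "2 ^ CARD('n) * (2 * N * real k powr s) + N < g x" if x: "real k < u x" for x
      proof -
        have "real k powr s < u x powr s"
          using x s by (intro powr_less_mono2) auto
        also have "u x powr s = g x / (N * B)"
          using s N B by (simp add: u_def powr_powr g_def)
        finally have "N * B * real k powr s < g x"
          using N B by (simp add: field_simps)
        moreover have "N * 1 \<le> N * real k powr s"
          using False N s by (intro mult_left_mono ge_one_powr_ge_zero) auto
        ultimately show ?thesis
          by (simp add: B_def algebra_simps)
      qed
      then have "{x \<in> space ?M. real k < u x} \<subseteq>
          {x \<in> cube a 1. 2 ^ CARD('n) * (2 * N * real k powr s) + N < g x}" (is "_ \<subseteq> ?L")
        by auto
      moreover have "?L \<in> sets ?M"
      proof -
        have "{x \<in> space ?M. 2 ^ CARD('n) * (2 * N * real k powr s) + N < g x} \<in> sets ?M"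
          using g unfolding borel_measurable_iff_greater by (rule spec)
        moreover have "space ?M = cube a 1" by simp
        ultimately show ?thesis by (simp only:)
      qed
      ultimately have "emeasure ?M {x \<in> space ?M. real k < u x} \<le> emeasure ?M ?L"
        by (rule emeasure_mono)
      also have "\<dots> \<le> ennreal (2 / 2 ^ k)"
        using superlevel_decay[OF f N(2,1) n] unfolding g_def s_def .
      finally show ?thesis .
    qed
    have half: "(\<integral>\<^sup>+x. ennreal (exp (u x / 2) - 1) \<partial>?M) \<le> ennreal K0"
      unfolding K0_def by (rule nn_integral_exp_half_bound[OF u _ tail]) (simp add: u_def)
    have "ennreal (exp ((g x / (C * N)) powr r) - 1) \<le> ennreal (1 / K) * ennreal (exp (u x / 2) - 1)" for x
    proof -
      have CN: "C * N = N * B * (2 * K) powr s" by (simp add: C_def)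
      have "(g x / (C * N)) powr r = (g x / (N * B) / (2 * K) powr s) powr r"
        unfolding CN by simp
      also have "\<dots> = u x / (2 * K)"
        using N B K s by (subst powr_divide) (auto simp: u_def g_def powr_powr)
      also have "\<dots> = (1 - 1 / K) *\<^sub>R 0 + (1 / K) *\<^sub>R (u x / 2)"
        by simp
      also have "exp \<dots> \<le> (1 - 1 / K) * exp 0 + (1 / K) * exp (u x / 2)"
        using K by (intro convex_onD[OF exp_convex]) auto
      finally have "exp ((g x / (C * N)) powr r) - 1 \<le> 1 / K * (exp (u x / 2) - 1)"
        by (simp add: algebra_simps)
      then show ?thesis
        using K by (subst ennreal_mult'[symmetric]) (auto intro: ennreal_leI)
    qed
    then have "(\<integral>\<^sup>+x. ennreal (exp ((g x / (C * N)) powr r) - 1) \<partial>?M)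
        \<le> (\<integral>\<^sup>+x. ennreal (1 / K) * ennreal (exp (u x / 2) - 1) \<partial>?M)"
      by (intro nn_integral_mono) auto
    also have "\<dots> = ennreal (1 / K) * (\<integral>\<^sup>+x. ennreal (exp (u x / 2) - 1) \<partial>?M)"
      by (intro nn_integral_cmult) measurable
    also have "\<dots> \<le> ennreal (1 / K) * ennreal K0"
      using half by (rule mult_left_mono) simp
    also have "\<dots> \<le> 1"
      using K by (simp add: ennreal_mult'[symmetric] ennreal_le_1)
    finally show ?thesis
      unfolding exp_Orlicz_norm_def g_def using C N(1) by (intro Inf_lower) auto
  qed
  ultimately show ?thesis
    using that unfolding r_def by blast
qed

section \<open>Boundedness for \<open>p > n\<close>\<close>

text \<open>A single cube of generation \<open>k\<close> has weight
  \<open>2 powr (k * (p - n))\<close> in the norm, so the family \<open>{Q}\<close> alone forces the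
  decay. Levels \<open>t\<close> strictly below the oscillation are used because the norm selects
  cubes by a strict inequality.\<close>

lemma mean_osc_decay:
  fixes a :: "real ^ 'n"
  assumes N: "O_norm p (cube a 1) f \<le> ennreal N" "0 < N" and p: "real CARD('n) < p"
    and Q: "Q \<in> dyadic_generation a k"
  shows "mean_osc f Q \<le> N * (2 powr (real CARD('n) / p - 1)) ^ k"
proof (rule dense_le)
  fix t assume t: "t < mean_osc f Q"
  let ?n = "real CARD('n)"
  define e where "e = real k * (p - ?n)"
  define r where "r = 2 powr (?n / p - 1)"
  have p0: "0 < p" using p by (smt (verit) of_nat_0_le_iff)
  have r: "0 < r" by (simp add: r_def)
  show "t \<le> N * r ^ k"
  proof (rule ccontr)
    assume "\<not> t \<le> N * r ^ k"
    then have less: "N * r ^ k < t" by simp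
    have t0: "0 < t"
      using less N(2) r by (smt (verit) mult_pos_pos zero_less_power)
    obtain c where c: "Q = cube c (1 / 2 ^ k)"
      using Q by (auto simp: dyadic_generation_def)
    have l: "1 / 2 ^ k = 2 powr (- real k)"
      by (simp add: powr_minus powr_realpow divide_inverse)
    have "sidelength Q powr (- p) * measure lebesgue Q = (1 / 2 ^ k) powr (- p) * (1 / 2 ^ k) powr ?n"
      using measure_cube[of "1 / 2 ^ k" c] sidelength_cube[of "1 / 2 ^ k" c]
      by (simp add: c powr_realpow)
    also have "\<dots> = 2 powr e"
      unfolding l powr_powr powr_add[symmetric] by (simp add: e_def algebra_simps)
    finally have "t powr p * 2 powr e \<le> N powr p"
      using O_norm_bound[OF N p0 t0, of "{Q}"] Q t dyadic_generation_subset[of a k] by auto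
    then have "t powr p \<le> N powr p * 2 powr (- e)"
      by (simp add: powr_minus_divide pos_le_divide_eq)
    also have "\<dots> = (N * r ^ k) powr p"
    proof -
      have "r ^ k = 2 powr (real k * (?n / p - 1))"
        by (simp add: r_def powr_realpow[symmetric] powr_powr mult.commute)
      moreover have "real k * (?n / p - 1) * p = - e"
        using p0 by (simp add: e_def field_simps)
      ultimately show ?thesis
        using N(2) r by (simp add: powr_mult powr_powr)
    qed
    finally show False
      using powr_less_mono2[OF p0 _ less] N(2) r by simp
  qed
qed

text \<open>The drift of the averages is bounded uniformly in \<open>k\<close>, so the threshold
  stays fixed while the measure bound \<open>r ^ k\<close> tends to 0.\<close>

lemma Linf_norm_bound:
  assumes p: "real CARD('n) < p"
  obtains C where "0 < C"
    "\<And>(a :: real ^ 'n) f N. \<lbrakk>integrable (lebesgue_on (cube a 1)) f; 0 < N;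
        O_norm p (cube a 1) f \<le> ennreal N\<rbrakk> \<Longrightarrow>
      Linf_norm (cube a 1) (\<lambda>x. f x - average f (cube a 1)) \<le> ennreal (C * N)"
proof -
  define r where "r = 2 powr (real CARD('n) / p - 1)"
  have p0: "0 < p" using p by (smt (verit) of_nat_0_le_iff)
  have r: "0 < r" "r < 1"
    using p p0 powr_less_cancel_iff[of 2 "real CARD('n) / p - 1" 0] by (auto simp: r_def)
  \<comment> \<open>\<open>A * N\<close> is \<open>2 ^ n\<close> times the full geometric series of
    the bounds \<open>N * r ^ i\<close>.\<close>
  define A where "A = 2 ^ CARD('n) / (1 - r)"
  have A: "0 < A" using r by (simp add: A_def)
  have "Linf_norm (cube a 1) (\<lambda>x. f x - average f (cube a 1)) \<le> ennreal ((A + 1) * N)"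
    if f: "integrable (lebesgue_on (cube a 1)) f" and N: "0 < N"
      "O_norm p (cube a 1) f \<le> ennreal N" for a :: "real ^ 'n" and f N
  proof -
    let ?M = "lebesgue_on (cube a 1)"
    let ?L = "{x \<in> cube a 1. A * N + N < \<bar>f x - average f (cube a 1)\<bar>}"
    have [measurable]: "f \<in> borel_measurable ?M"
      using f by (rule borel_measurable_integrable)
    have osc: "mean_osc f Q \<le> N * r ^ k" if "Q \<in> dyadic_generation a k" for Q k
      unfolding r_def by (rule mean_osc_decay[OF N(2,1) p that])
    have "emeasure ?M ?L \<le> ennreal (r ^ k)" for k
    proof -
      have "emeasure ?M ?L \<le> ennreal ((\<Sum>Q\<in>dyadic_generation a k. mean_osc f Q) / (2 ^ (CARD('n) * k) * N))"
      proof (rule superlevel_measure_bound[OF f N(1)])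
        fix Q assume Q: "Q \<in> dyadic_generation a k"
        obtain q where q: "\<And>i. i < k \<Longrightarrow> q i \<in> dyadic_generation a i"
          "\<bar>average f Q - average f (cube a 1)\<bar> \<le> 2 ^ CARD('n) * (\<Sum>i<k. mean_osc f (q i))"
          using average_chain[OF f Q] by blast
        have "(\<Sum>i<k. mean_osc f (q i)) \<le> (\<Sum>i<k. N * r ^ i)"
          using q(1) osc by (intro sum_mono) auto
        also have "\<dots> = N * ((1 - r ^ k) / (1 - r))"
          using r by (simp add: sum_distrib_left[symmetric] sum_gp_strict)
        also have "\<dots> \<le> N * (1 / (1 - r))"
          using N r by (intro mult_left_mono divide_right_mono) auto
        finally have "2 ^ CARD('n) * (\<Sum>i<k. mean_osc f (q i)) \<le> 2 ^ CARD('n) * (N * (1 / (1 - r)))"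
          by (rule mult_left_mono) simp
        then show "\<bar>average f Q - average f (cube a 1)\<bar> \<le> A * N"
          using q(2) by (simp add: A_def)
      qed
      also have "\<dots> \<le> ennreal (r ^ k)"
      proof (rule ennreal_leI)
        have "(\<Sum>Q\<in>dyadic_generation a k. mean_osc f Q) \<le> (\<Sum>Q\<in>dyadic_generation a k. N * r ^ k)"
          using osc by (intro sum_mono) auto
        also have "\<dots> = real (card (dyadic_generation a k)) * (N * r ^ k)"
          by simp
        also have "\<dots> \<le> real (2 ^ (CARD('n) * k)) * (N * r ^ k)"
          using N r by (intro mult_right_mono of_nat_mono card_dyadic_generation) auto
        finally show "(\<Sum>Q\<in>dyadic_generation a k. mean_osc f Q) / (2 ^ (CARD('n) * k) * N) \<le> r ^ k"
          using N by (simp add: field_simps)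
      qed
      finally show ?thesis .
    qed
    moreover have "(\<lambda>k. ennreal (r ^ k)) \<longlonglongrightarrow> ennreal 0"
      using r by (intro tendsto_ennrealI LIMSEQ_power_zero) auto
    ultimately have "emeasure ?M ?L \<le> ennreal 0"
      by (intro LIMSEQ_le_const[of "\<lambda>k. ennreal (r ^ k)"]) auto
    then have "?L \<in> null_sets ?M"
    proof (intro null_setsI)
      have "{x \<in> space ?M. A * N + N < \<bar>f x - average f (cube a 1)\<bar>} \<in> sets ?M"
        by measurable
      then show "?L \<in> sets ?M" by simp
    qed simp
    then have "AE x in ?M. x \<notin> ?L" by (rule AE_not_in)
    then have "AE x in ?M. \<bar>f x - average f (cube a 1)\<bar> \<le> (A + 1) * N"
      using AE_space by eventually_elim (auto simp: algebra_simps not_less)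
    then have "AE x in ?M. ennreal \<bar>f x - average f (cube a 1)\<bar> \<le> ennreal ((A + 1) * N)"
      by eventually_elim (rule ennreal_leI)
    then show ?thesis
      unfolding Linf_norm_def by (intro esssup_I) measurable
  qed
  with A show ?thesis
    by (intro that[of "A + 1"]) auto
qed

section \<open>From real bounds to extended norms\<close>

text \<open>The estimates above assume a positive real bound \<open>N\<close> on the norm; this
  covers the norms 0 and infinity as well.\<close>

lemma ennreal_le_mult_of_real_bounds:
  assumes C: "0 < C" and le: "\<And>N. \<lbrakk>0 < N; y \<le> ennreal N\<rbrakk> \<Longrightarrow> x \<le> ennreal (C * N)"
  shows "x \<le> ennreal C * y"
proof (cases y)
  case top
  then show ?thesis using C by (simp add: ennreal_mult_top)
next
  case (real r)
  show ?thesis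
  proof (rule ennreal_le_epsilon)
    fix e :: real assume e: "0 < e"
    \<comment> \<open>Adding \<open>e / C\<close> keeps the bound positive even for
      \<open>r = 0\<close> and costs only \<open>e\<close> after multiplication by
      \<open>C\<close>.\<close>
    have "x \<le> ennreal (C * (r + e / C))"
      using real e C by (intro le) (auto intro: ennreal_leI add_nonneg_pos)
    also have "C * (r + e / C) = C * r + e"
      using C by (simp add: field_simps)
    also have "ennreal \<dots> = ennreal C * y + ennreal e"
      using C real e by (simp add: ennreal_mult')
    finally show "x \<le> ennreal C * y + ennreal e" .
  qed
qed

theorem theorem2p2:
  shows "(CARD('n::finite) \<ge> 2 \<longrightarrow>
           (\<exists>C::real. C > 0 \<and> (\<forall>(Q0 :: (real ^ 'n) set) f.
              is_cube Q0 \<and> measure lebesgue Q0 = 1 \<and> integrable (lebesgue_on Q0) f \<longrightarrow>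
              exp_Orlicz_norm (real CARD('n) / (real CARD('n) - 1)) Q0 (\<lambda>x. f x - average f Q0)
                \<le> ennreal C * O_norm (real CARD('n)) Q0 f))) \<and>
         (\<forall>p::real. real CARD('n) < p \<longrightarrow>
           (\<exists>C::real. C > 0 \<and> (\<forall>(Q0 :: (real ^ 'n) set) f.
              is_cube Q0 \<and> measure lebesgue Q0 = 1 \<and> integrable (lebesgue_on Q0) f \<longrightarrow>
              Linf_norm Q0 (\<lambda>x. f x - average f Q0) \<le> ennreal C * O_norm p Q0 f)))"
proof (intro conjI impI allI)
  assume "2 \<le> CARD('n)"
  then obtain C where C: "0 < C"
    "\<And>(a :: real ^ 'n) f N. \<lbrakk>integrable (lebesgue_on (cube a 1)) f; 0 < N;
        O_norm (real CARD('n)) (cube a 1) f \<le> ennreal N\<rbrakk> \<Longrightarrow>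
      exp_Orlicz_norm (real CARD('n) / (real CARD('n) - 1)) (cube a 1) (\<lambda>x. f x - average f (cube a 1))
        \<le> ennreal (C * N)"
    using exp_Orlicz_norm_bound by blast
  show "\<exists>C::real. C > 0 \<and> (\<forall>(Q0 :: (real ^ 'n) set) f.
              is_cube Q0 \<and> measure lebesgue Q0 = 1 \<and> integrable (lebesgue_on Q0) f \<longrightarrow>
              exp_Orlicz_norm (real CARD('n) / (real CARD('n) - 1)) Q0 (\<lambda>x. f x - average f Q0)
                \<le> ennreal C * O_norm (real CARD('n)) Q0 f)"
    using C by (intro exI[of _ C]) (auto elim!: is_cube_unit intro: ennreal_le_mult_of_real_bounds)
next
  fix p assume "real CARD('n) < p"
  then obtain C where C: "0 < C"
    "\<And>(a :: real ^ 'n) f N. \<lbrakk>integrable (lebesgue_on (cube a 1)) f; 0 < N;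
        O_norm p (cube a 1) f \<le> ennreal N\<rbrakk> \<Longrightarrow>
      Linf_norm (cube a 1) (\<lambda>x. f x - average f (cube a 1)) \<le> ennreal (C * N)"
    using Linf_norm_bound by blast
  show "\<exists>C::real. C > 0 \<and> (\<forall>(Q0 :: (real ^ 'n) set) f.
              is_cube Q0 \<and> measure lebesgue Q0 = 1 \<and> integrable (lebesgue_on Q0) f \<longrightarrow>
              Linf_norm Q0 (\<lambda>x. f x - average f Q0) \<le> ennreal C * O_norm p Q0 f)"
    using C by (intro exI[of _ C]) (auto elim!: is_cube_unit intro: ennreal_le_mult_of_real_bounds)
qed

end
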